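(* Let $Z$ be a finite set of cardinality $m\ge4$. Then the big-Teichmuller space $(\mathcal{T}(Z),d_{\text{Möb}})$ is a geodesic metric space. Moreover, it is geodesically complete and it is homeomorphic to the open simplex $\mathring\Delta^{p_m}$ of dimension $p_m:=\frac{m(m-3)}{2}$, equipped with the subspace topology from $\mathbb{R}^{1+p_m}$.
   Context: Let $Z$ be a finite set. A separating function on $Z$ is a symmetric function $\rho:Z\times Z\to[0,\infty)$ with $\rho(\xi,\eta)=0$ iff $\xi=\eta$. Its cross-ratio for distinct $\xi,\xi',\eta,\eta'\in Z$ is $[\xi,\xi',\eta,\eta']_\rho=\frac{\rho(\xi,\eta)\rho(\xi',\eta')}{\rho(\xi,\eta')\rho(\xi',\eta)}$. Two separating functions are Moebius equivalent ($\sim_M$) if they have the same cross-ratios for all quadruples of distinct points. A separating function $\rho$ is antipodal if $\max\rho=1$ and for every $\xi\in Z$ there is $\eta\in Z$ with $\rho(\xi,\eta)=1$. Let $\mathscr{A}(Z)$ be the set of antipodal functions on $Z$. The big-Teichmuller space is the quotient set $\mathcal{T}(Z)=\mathscr{A}(Z)/\!\sim_M$; the class of $\rho$ is denoted $\mathcal{M}(\rho)$. Define $$d_{\text{Möb}}(\mathcal{M}(\rho),\mathcal{M}(\rho'))=\sup_{\xi,\eta,\xi',\eta'\text{ distinct in }Z}\log\frac{[\xi,\xi',\eta,\eta']_\rho}{[\xi,\xi',\eta,\eta']_{\rho'}} .$$ A geodesic in a metric space $T$ is an isometric embedding $I\to T$ of an interval $I\subseteq\mathbb{R}$. $T$ is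 geodesic if any two points are joined by a geodesic segment, and geodesically complete if it is geodesic and every geodesic $I\to T$ extends to a bi-infinite geodesic $\mathbb{R}\to T$. The open simplex is $\mathring\Delta^{p_m}=\{x\in\mathbb{R}^{1+p_m}: x_i>0 \text{ for all } i,\ \sum_{i=1}^{1+p_m}x_i=1\}$. *)

theory Defs
  imports "HOL-Analysis.Analysis"
begin

text \<open>
  A function on $Z \times Z$ is an element of \<open>Z \<times> Z \<rightarrow>\<^sub>E _\<close>, i.e. it is \<open>undefined\<close> outside
  \<open>Z \<times> Z\<close>, so that functions are equal iff they agree on \<open>Z \<times> Z\<close>.
\<close>

definition separating :: "'a set \<Rightarrow> ('a \<times> 'a \<Rightarrow> real) \<Rightarrow> bool" where
  "separating Z \<rho> \<longleftrightarrow>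
     \<rho> \<in> Z \<times> Z \<rightarrow>\<^sub>E {0..} \<and>
     (\<forall>\<xi>\<in>Z. \<forall>\<eta>\<in>Z. \<rho> (\<xi>, \<eta>) = \<rho> (\<eta>, \<xi>)) \<and>
     (\<forall>\<xi>\<in>Z. \<forall>\<eta>\<in>Z. \<rho> (\<xi>, \<eta>) = 0 \<longleftrightarrow> \<xi> = \<eta>)"

definition quads :: "'a set \<Rightarrow> ('a \<times> 'a \<times> 'a \<times> 'a) set" where
  "quads Z = {(\<xi>, \<xi>', \<eta>, \<eta>'). {\<xi>, \<xi>', \<eta>, \<eta>'} \<subseteq> Z \<and> distinct [\<xi>, \<xi>', \<eta>, \<eta>']}"

fun cross_ratio :: "('a \<times> 'a \<Rightarrow> real) \<Rightarrow> 'a \<times> 'a \<times> 'a \<times> 'a \<Rightarrow> real" where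
  "cross_ratio \<rho> (\<xi>, \<xi>', \<eta>, \<eta>') = (\<rho> (\<xi>, \<eta>) * \<rho> (\<xi>', \<eta>')) / (\<rho> (\<xi>, \<eta>') * \<rho> (\<xi>', \<eta>))"

definition moebius_equiv ::
    "'a set \<Rightarrow> ('a \<times> 'a \<Rightarrow> real) \<Rightarrow> ('a \<times> 'a \<Rightarrow> real) \<Rightarrow> bool" where
  "moebius_equiv Z \<rho> \<rho>' \<longleftrightarrow> (\<forall>q\<in>quads Z. cross_ratio \<rho> q = cross_ratio \<rho>' q)"

definition antipodal_functions :: "'a set \<Rightarrow> ('a \<times> 'a \<Rightarrow> real) set" where
  "antipodal_functions Z =
     {\<rho>. separating Z \<rho> \<and> Max (\<rho> ` (Z \<times> Z)) = 1 \<and> (\<forall>\<xi>\<in>Z. \<exists>\<eta>\<in>Z. \<rho> (\<xi>, \<eta>) = 1)}"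

definition moebius_rel :: "'a set \<Rightarrow> (('a \<times> 'a \<Rightarrow> real) \<times> ('a \<times> 'a \<Rightarrow> real)) set" where
  "moebius_rel Z =
     {(\<rho>, \<rho>'). \<rho> \<in> antipodal_functions Z \<and> \<rho>' \<in> antipodal_functions Z \<and> moebius_equiv Z \<rho> \<rho>'}"

definition moebius_class :: "'a set \<Rightarrow> ('a \<times> 'a \<Rightarrow> real) \<Rightarrow> ('a \<times> 'a \<Rightarrow> real) set" where
  "moebius_class Z \<rho> = moebius_rel Z `` {\<rho>}"

definition big_teichmuller :: "'a set \<Rightarrow> ('a \<times> 'a \<Rightarrow> real) set set" where
  "big_teichmuller Z = antipodal_functions Z // moebius_rel Z"

definition moebius_sup ::
    "'a set \<Rightarrow> ('a \<times> 'a \<Rightarrow> real) \<Rightarrow> ('a \<times> 'a \<Rightarrow> real) \<Rightarrow> real" where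
  "moebius_sup Z \<rho> \<rho>' = (SUP q\<in>quads Z. ln (cross_ratio \<rho> q / cross_ratio \<rho>' q))"

text \<open>
  The value of \<open>moebius_sup\<close> does not depend on the representatives (see \<open>moebius_dist_class\<close>
  below), so the image is a singleton. The value \<open>0\<close> off the carrier is needed because
  \<^locale>\<open>Metric_space\<close> demands symmetry and nonnegativity on the whole type.
\<close>

definition moebius_dist ::
    "'a set \<Rightarrow> ('a \<times> 'a \<Rightarrow> real) set \<Rightarrow> ('a \<times> 'a \<Rightarrow> real) set \<Rightarrow> real" where
  "moebius_dist Z C C' =
     (if C \<in> big_teichmuller Z \<and> C' \<in> big_teichmuller Z
      then the_elem ((\<lambda>(\<rho>, \<rho>'). moebius_sup Z \<rho> \<rho>') ` (C \<times> C')) else 0)"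

lemma equiv_moebius_rel: "equiv (antipodal_functions Z) (moebius_rel Z)"
  by (auto simp: equiv_def refl_on_def sym_def trans_def moebius_rel_def moebius_equiv_def)

lemma moebius_sup_cong:
  assumes "moebius_equiv Z \<rho>1 \<rho>2" "moebius_equiv Z \<rho>1' \<rho>2'"
  shows "moebius_sup Z \<rho>1 \<rho>1' = moebius_sup Z \<rho>2 \<rho>2'"
  using assms unfolding moebius_sup_def moebius_equiv_def by (intro SUP_cong) auto

lemma moebius_dist_class:
  assumes "\<rho> \<in> antipodal_functions Z" "\<rho>' \<in> antipodal_functions Z"
  shows "moebius_dist Z (moebius_class Z \<rho>) (moebius_class Z \<rho>') =
    (SUP q\<in>quads Z. ln (cross_ratio \<rho> q / cross_ratio \<rho>' q))"
proof -
  let ?C = "moebius_class Z \<rho>" and ?C' = "moebius_class Z \<rho>'"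
  have mem: "\<rho> \<in> ?C" "\<rho>' \<in> ?C'"
    using assms by (auto simp: moebius_class_def moebius_rel_def moebius_equiv_def)
  have eq: "moebius_sup Z r r' = moebius_sup Z \<rho> \<rho>'" if "r \<in> ?C" "r' \<in> ?C'" for r r'
    using that moebius_sup_cong[of Z \<rho> r \<rho>' r']
    by (auto simp: moebius_class_def moebius_rel_def)
  have img: "(\<lambda>(r, r'). moebius_sup Z r r') ` (?C \<times> ?C') = {moebius_sup Z \<rho> \<rho>'}"
  proof (intro equalityI subsetI)
    fix x assume "x \<in> (\<lambda>(r, r'). moebius_sup Z r r') ` (?C \<times> ?C')"
    then show "x \<in> {moebius_sup Z \<rho> \<rho>'}" using eq by auto
  next
    fix x assume "x \<in> {moebius_sup Z \<rho> \<rho>'}"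
    then show "x \<in> (\<lambda>(r, r'). moebius_sup Z r r') ` (?C \<times> ?C')"
      using mem by (auto intro!: image_eqI[where x = "(\<rho>, \<rho>')"])
  qed
  have "?C \<in> big_teichmuller Z" "?C' \<in> big_teichmuller Z"
    using assms by (auto simp: moebius_class_def big_teichmuller_def intro: quotientI)
  then show ?thesis
    by (simp add: moebius_dist_def img) (simp add: moebius_sup_def)
qed

context Metric_space
begin

definition geodesic_on :: "real set \<Rightarrow> (real \<Rightarrow> 'a) \<Rightarrow> bool" where
  "geodesic_on I \<gamma> \<longleftrightarrow>
     is_interval I \<and> \<gamma> ` I \<subseteq> M \<and> (\<forall>s\<in>I. \<forall>t\<in>I. d (\<gamma> s) (\<gamma> t) = dist s t)"

definition geodesic_space :: bool where
  "geodesic_space \<longleftrightarrow>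
     (\<forall>x\<in>M. \<forall>y\<in>M. \<exists>a b \<gamma>. a \<le> b \<and> geodesic_on {a..b} \<gamma> \<and> \<gamma> a = x \<and> \<gamma> b = y)"

definition geodesically_complete :: bool where
  "geodesically_complete \<longleftrightarrow>
     geodesic_space \<and>
     (\<forall>I \<gamma>. geodesic_on I \<gamma> \<longrightarrow> (\<exists>\<gamma>'. geodesic_on UNIV \<gamma>' \<and> (\<forall>t\<in>I. \<gamma>' t = \<gamma> t)))"

end

text \<open>
  \<^const>\<open>Euclidean_space\<close> \<open>n\<close> is $R^n$ realised as the space of real sequences that vanish from
  index \<open>n\<close> on; coordinates are numbered from \<open>0\<close>.
\<close>

definition open_simplex :: "nat \<Rightarrow> (nat \<Rightarrow> real) set" where
  "open_simplex p =
     {x \<in> topspace (Euclidean_space (1 + p)). (\<forall>i<1 + p. 0 < x i) \<and> (\<Sum>i<1 + p. x i) = 1}"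

end

theory Submission
  imports Defs
begin

text \<open>
  Logarithms turn separating functions into arbitrary real weights on the edges of the complete graph
  on \<open>Z\<close>, cross-ratios into linear functionals of the weights, and every weight is Moebius equivalent
  to that of an antipodal function. So the Moebius classes form a finite-dimensional real vector space
  on which \<open>moebius_dist\<close> is the maximum of finitely many linear functionals, a polyhedral norm.
  Straight segments are geodesics. Along any geodesic a single functional realises all distances,
  so a geodesic can be prolonged by straight rays in a unit direction on which that functional is \<open>1\<close>.
\<close>

text \<open>Adding \<open>f \<xi> + f \<eta>\<close> to the edge weights, for any potential f on the
  points, changes no cross-ratio; this leaves dimension (m choose 2) - m = m(m - 3)/2. Through a
  base point the count reads differently: 1 + m(m - 3)/2 edges avoid it, and normalising the sum of
  their values to 1 fixes the remaining common factor. The norm is not strictly convex, so a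
  geodesic may bend and need not have a tangent at its ends along which to go on. A supporting
  functional replaces the tangent: all functionals are 1-Lipschitz along a geodesic, so one that
  attains the distance between two parameters does so on every interval between them. Finitely many
  functionals then make one serve an unbounded geodesic as well. A domain without its endpoints is
  first closed up, which needs the closedness in \<open>limit\<close>; an empty or one-point domain
  has no direction of its own, which is what \<open>nontrivial\<close> supplies.\<close>

section \<open>Metrics given by finitely many linear coordinates\<close>

text \<open>
  The assumptions say that the coordinates identify \<open>T\<close> with a closed nonzero linear subspace of
  $R^Q$, on which \<open>d\<close> is the distance of the supremum norm.
\<close>

locale coordinate_metric =
  fixes T :: "'c set" and Q :: "'q set" and L :: "'q \<Rightarrow> 'c \<Rightarrow> real" and d :: "'c \<Rightarrow> 'c \<Rightarrow> real"
  assumes finite_Q: "finite Q"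
    and neg: "q \<in> Q \<Longrightarrow> \<exists>q'\<in>Q. \<forall>x\<in>T. L q' x = - L q x"
    and sep: "x \<in> T \<Longrightarrow> y \<in> T \<Longrightarrow> (\<And>q. q \<in> Q \<Longrightarrow> L q x = L q y) \<Longrightarrow> x = y"
    and affine: "x \<in> T \<Longrightarrow> y \<in> T \<Longrightarrow> z \<in> T \<Longrightarrow> \<exists>w\<in>T. \<forall>q\<in>Q. L q w = L q x + c * (L q y - L q z)"
    and limit: "(\<And>n::nat. X n \<in> T) \<Longrightarrow> (\<And>q. q \<in> Q \<Longrightarrow> (\<lambda>n. L q (X n)) \<longlonglongrightarrow> l q)
                 \<Longrightarrow> \<exists>w\<in>T. \<forall>q\<in>Q. L q w = l q"
    and nontrivial: "\<exists>x\<in>T. \<exists>y\<in>T. x \<noteq> y"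
    and d_eq: "x \<in> T \<Longrightarrow> y \<in> T \<Longrightarrow> d x y = (SUP q\<in>Q. L q x - L q y)"
    and d_off: "\<not> (x \<in> T \<and> y \<in> T) \<Longrightarrow> d x y = 0"
begin

section \<open>Finite maxima and the metric axioms\<close>

lemma Q_nonempty: "Q \<noteq> {}"
  using nontrivial sep by blast

lemma coordinate_diff_le:
  assumes "x \<in> T" "y \<in> T" "q \<in> Q"
  shows "L q x - L q y \<le> d x y"
  unfolding d_eq[OF assms(1,2)] using assms(3) finite_Q by (intro cSUP_upper bdd_above_finite) auto

lemma dist_attained:
  assumes "x \<in> T" "y \<in> T"
  shows "\<exists>q\<in>Q. L q x - L q y = d x y"
proof -
  have "d x y \<in> (\<lambda>q. L q x - L q y) ` Q"
    unfolding d_eq[OF assms] using finite_Q Q_nonempty by (subst cSup_eq_Max) (auto intro!: Max_in)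
  then show ?thesis by force
qed

lemma dist_eqI:
  assumes "x \<in> T" "y \<in> T" "\<And>q. q \<in> Q \<Longrightarrow> L q x - L q y \<le> r" "q0 \<in> Q" "L q0 x - L q0 y = r"
  shows "d x y = r"
proof -
  obtain q where "q \<in> Q" "L q x - L q y = d x y"
    using dist_attained[OF assms(1,2)] by blast
  with assms(3)[of q] coordinate_diff_le[OF assms(1,2,4)] assms(5) show ?thesis
    by simp
qed

text \<open>\<open>neg\<close> turns a coordinate that attains \<open>d x y\<close> into one whose
  difference is bounded by \<open>d y x\<close>.\<close>

lemma dist_commute_on:
  assumes "x \<in> T" "y \<in> T"
  shows "d x y = d y x"
proof -
  have "d x y \<le> d y x" if xy: "x \<in> T" "y \<in> T" for x y
  proof -
    obtain q where q: "q \<in> Q" "L q x - L q y = d x y"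
      using dist_attained xy by blast
    obtain q' where q': "q' \<in> Q" "\<forall>x\<in>T. L q' x = - L q x"
      using neg q by blast
    then show ?thesis
      using coordinate_diff_le[OF xy(2,1) q'(1)] q xy by auto
  qed
  then show ?thesis
    using assms by (meson order_antisym)
qed

lemma abs_coordinate_diff_le:
  assumes "x \<in> T" "y \<in> T" "q \<in> Q"
  shows "\<bar>L q x - L q y\<bar> \<le> d x y"
  using coordinate_diff_le[of x y q] coordinate_diff_le[of y x q] dist_commute_on[of x y] assms
  by (simp add: abs_le_iff)

sublocale Metric_space T d
proof
  fix x y
  show "0 \<le> d x y"
  proof (cases "x \<in> T \<and> y \<in> T")
    case True
    obtain q where "q \<in> Q" using Q_nonempty by blast
    then show ?thesis
      using abs_coordinate_diff_le[of x y q] True by linarith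
  qed (simp add: d_off)
  show "d x y = d y x"
    using dist_commute_on[of x y] d_off[of x y] d_off[of y x] by (cases "x \<in> T \<and> y \<in> T") auto
next
  fix x y assume xy: "x \<in> T" "y \<in> T"
  have "x = y" if "d x y = 0"
    using abs_coordinate_diff_le[OF xy] that by (intro sep xy) auto
  moreover have "d x x = 0"
    using dist_attained xy(1) by force
  ultimately show "d x y = 0 \<longleftrightarrow> x = y"
    by auto
next
  fix x y z assume xyz: "x \<in> T" "y \<in> T" "z \<in> T"
  then obtain q where "q \<in> Q" "L q x - L q z = d x z"
    using dist_attained by blast
  then show "d x z \<le> d x y + d y z"
    using coordinate_diff_le[of x y q] coordinate_diff_le[of y z q] xyz by auto
qed

section \<open>Geodesics: calibration, segments and prolongation\<close>

lemma geodesic_onI: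
  assumes "is_interval I" "\<And>t. t \<in> I \<Longrightarrow> \<gamma> t \<in> T" "q0 \<in> Q"
    and "\<And>q s t. q \<in> Q \<Longrightarrow> s \<in> I \<Longrightarrow> t \<in> I \<Longrightarrow> s \<le> t \<Longrightarrow> L q (\<gamma> t) - L q (\<gamma> s) \<le> t - s"
    and "\<And>s t. s \<in> I \<Longrightarrow> t \<in> I \<Longrightarrow> s \<le> t \<Longrightarrow> L q0 (\<gamma> t) - L q0 (\<gamma> s) = t - s"
  shows "geodesic_on I \<gamma>"
proof -
  \<comment> \<open>The coordinate \<open>q0\<close> attains the bound that all coordinates obey, so
    it calibrates the path; pairs with s > t follow by symmetry of \<open>d\<close>.\<close>
  have *: "d (\<gamma> t) (\<gamma> s) = t - s" if "s \<in> I" "t \<in> I" "s \<le> t" for s t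
    using that by (intro dist_eqI[OF _ _ _ assms(3)] assms)
  have "d (\<gamma> s) (\<gamma> t) = dist s t" if "s \<in> I" "t \<in> I" for s t
    using *[of s t] *[of t s] that commute[of "\<gamma> s" "\<gamma> t"]
    by (cases "s \<le> t") (auto simp: dist_real_def)
  then show ?thesis
    using assms(1,2) by (auto simp: geodesic_on_def)
qed

lemma geodesic_space: "geodesic_space"
  unfolding geodesic_space_def
proof (intro ballI)
  fix x y assume xy: "x \<in> T" "y \<in> T"
  define r where "r = d x y"
  \<comment> \<open>Coincident points are covered: then r = 0, the quotient \<open>t / r\<close> is
    0, and the path is constant on the single parameter 0.\<close>
  have "\<forall>t. \<exists>w\<in>T. \<forall>q\<in>Q. L q w = L q x + (t / r) * (L q y - L q x)"
    using affine xy by blast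
  then obtain \<gamma> where \<gamma>: "\<And>t. \<gamma> t \<in> T" "\<And>t q. q \<in> Q \<Longrightarrow> L q (\<gamma> t) = L q x + (t / r) * (L q y - L q x)"
    by metis
  have r0: "r \<ge> 0" by (simp add: r_def)
  have le: "L q y - L q x \<le> r" if "q \<in> Q" for q
    using coordinate_diff_le[of y x q] xy that commute[of x y] by (simp add: r_def)
  obtain q0 where q0: "q0 \<in> Q" "L q0 y - L q0 x = r"
    using dist_attained[of y x] xy commute[of x y] by (auto simp: r_def)
  have "geodesic_on {0..r} \<gamma>"
  proof (rule geodesic_onI[OF _ _ q0(1)])
    fix q s t assume q: "q \<in> Q" and st: "s \<in> {0..r}" "t \<in> {0..r}" "s \<le> t"
    have "L q (\<gamma> t) - L q (\<gamma> s) = (t - s) / r * (L q y - L q x)"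
      using \<gamma>(2)[OF q] by (simp add: diff_divide_distrib algebra_simps)
    also have "\<dots> \<le> (t - s) / r * r"
      using le[OF q] st r0 by (intro mult_left_mono) auto
    also have "\<dots> \<le> t - s"
      using st by auto
    finally show "L q (\<gamma> t) - L q (\<gamma> s) \<le> t - s" .
  next
    fix s t assume st: "s \<in> {0..r}" "t \<in> {0..r}" "s \<le> t"
    have "L q0 (\<gamma> t) - L q0 (\<gamma> s) = (t - s) / r * r"
      using \<gamma>(2)[OF q0(1)] q0(2) by (simp add: diff_divide_distrib algebra_simps)
    also have "\<dots> = t - s"
      using st by auto
    finally show "L q0 (\<gamma> t) - L q0 (\<gamma> s) = t - s" .
  qed (use \<gamma> in auto)
  moreover have "\<gamma> 0 = x"
    using \<gamma> xy by (intro sep) auto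
  moreover have "\<gamma> r = y"
  proof (intro sep)
    fix q assume "q \<in> Q"
    then show "L q (\<gamma> r) = L q y"
      using \<gamma>(2)[of q r] abs_coordinate_diff_le[of x y q] xy by (cases "r = 0") (auto simp: r_def)
  qed (use \<gamma> xy in auto)
  ultimately show "\<exists>a b \<gamma>. a \<le> b \<and> geodesic_on {a..b} \<gamma> \<and> \<gamma> a = x \<and> \<gamma> b = y"
    using r0 by blast
qed

text \<open>
  For each bad coordinate choose a pair of parameters witnessing it; a coordinate attaining the
  distance between the extreme chosen parameters cannot be bad.
\<close>

lemma geodesic_supporting_coordinate:
  assumes "geodesic_on I \<gamma>" "I \<noteq> {}"
  shows "\<exists>q\<in>Q. \<forall>s\<in>I. \<forall>t\<in>I. s \<le> t \<longrightarrow> L q (\<gamma> t) - L q (\<gamma> s) = t - s"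
proof (rule ccontr)
  have \<gamma>: "\<gamma> t \<in> T" if "t \<in> I" for t
    using assms that by (auto simp: geodesic_on_def)
  have le: "L q (\<gamma> t) - L q (\<gamma> s) \<le> t - s" if "q \<in> Q" "s \<in> I" "t \<in> I" "s \<le> t" for q s t
    using coordinate_diff_le[of "\<gamma> t" "\<gamma> s" q] \<gamma> that assms by (auto simp: geodesic_on_def dist_real_def)
  assume "\<not> ?thesis"
  then have "\<forall>q\<in>Q. \<exists>p. fst p \<in> I \<and> snd p \<in> I \<and> fst p \<le> snd p \<and>
      L q (\<gamma> (snd p)) - L q (\<gamma> (fst p)) \<noteq> snd p - fst p"
    by (fastforce simp: Bex_def)
  then obtain p where p: "\<And>q. q \<in> Q \<Longrightarrow> fst (p q) \<in> I \<and> snd (p q) \<in> I \<and> fst (p q) \<le> snd (p q) \<and>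
      L q (\<gamma> (snd (p q))) - L q (\<gamma> (fst (p q))) \<noteq> snd (p q) - fst (p q)"
    by metis
  define a where "a = Min (fst ` p ` Q)"
  define b where "b = Max (snd ` p ` Q)"
  have "a \<in> fst ` p ` Q" "b \<in> snd ` p ` Q"
    unfolding a_def b_def using finite_Q Q_nonempty by (intro Min_in Max_in; simp)+
  then have ab: "a \<in> I" "b \<in> I"
    using p by auto
  have bounds: "a \<le> fst (p q)" "snd (p q) \<le> b" if "q \<in> Q" for q
    unfolding a_def b_def using finite_Q that by auto
  obtain q0 where "q0 \<in> Q" using Q_nonempty by blast
  then have "a \<le> b"
    using bounds[of q0] p[of q0] by linarith
  then obtain q where q: "q \<in> Q" "L q (\<gamma> b) - L q (\<gamma> a) = b - a"
    using dist_attained[of "\<gamma> b" "\<gamma> a"] \<gamma> ab assms(1) by (auto simp: geodesic_on_def dist_real_def)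
  \<comment> \<open>Between a and b the increment of q is a sum of three increments, each at most
    the length of its interval; equality for the sum forces equality on the middle one, the interval
    chosen to violate it.\<close>
  then show False
    using p[OF q(1)] bounds[OF q(1)] le[of q a "fst (p q)"] le[of q "fst (p q)" "snd (p q)"]
      le[of q "snd (p q)" b] ab by linarith
qed

text \<open>The direction has coordinates \<open>c * (L q x - L q y)\<close> with c = 1 / d x y, and
  one \<open>q0\<close> must both support the geodesic and attain the norm of the direction. A
  nondegenerate geodesic offers one of its own chords; on a single parameter the support condition
  is trivial and any two distinct points do.\<close>

lemma unit_direction:
  assumes "geodesic_on I \<gamma>" "I \<noteq> {}"
  obtains q0 x y c where "q0 \<in> Q" "x \<in> T" "y \<in> T"
    and "\<And>q. q \<in> Q \<Longrightarrow> c * (L q x - L q y) \<le> 1" "c * (L q0 x - L q0 y) = 1"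
    and "\<And>s t. s \<in> I \<Longrightarrow> t \<in> I \<Longrightarrow> s \<le> t \<Longrightarrow> L q0 (\<gamma> t) - L q0 (\<gamma> s) = t - s"
proof -
  have *: "\<exists>x\<in>T. \<exists>y\<in>T. x \<noteq> y \<and> (\<exists>q0\<in>Q. L q0 x - L q0 y = d x y \<and>
    (\<forall>s\<in>I. \<forall>t\<in>I. s \<le> t \<longrightarrow> L q0 (\<gamma> t) - L q0 (\<gamma> s) = t - s))"
  proof (cases "\<exists>a\<in>I. \<exists>b\<in>I. a < b")
    case True
    then obtain a b where ab: "a \<in> I" "b \<in> I" "a < b" by auto
    obtain q0 where q0: "q0 \<in> Q" "\<forall>s\<in>I. \<forall>t\<in>I. s \<le> t \<longrightarrow> L q0 (\<gamma> t) - L q0 (\<gamma> s) = t - s"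
      using geodesic_supporting_coordinate assms by blast
    have "L q0 (\<gamma> b) - L q0 (\<gamma> a) = d (\<gamma> b) (\<gamma> a)" "\<gamma> b \<in> T" "\<gamma> a \<in> T"
      using q0 ab assms(1) by (auto simp: geodesic_on_def dist_real_def)
    moreover have "\<gamma> b \<noteq> \<gamma> a"
      using q0(2) ab by force
    ultimately show ?thesis
      using q0 by blast
  next
    case False
    then have single: "s = t" if "s \<in> I" "t \<in> I" for s t
      using that by (meson linorder_neqE)
    obtain x y where xy: "x \<in> T" "y \<in> T" "x \<noteq> y"
      using nontrivial by blast
    then obtain q0 where "q0 \<in> Q" "L q0 x - L q0 y = d x y"
      using dist_attained by blast
    moreover have "\<forall>s\<in>I. \<forall>t\<in>I. s \<le> t \<longrightarrow> L q0 (\<gamma> t) - L q0 (\<gamma> s) = t - s"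
    proof (intro ballI impI)
      fix s t assume "s \<in> I" "t \<in> I"
      then have "s = t" by (rule single)
      then show "L q0 (\<gamma> t) - L q0 (\<gamma> s) = t - s" by simp
    qed
    ultimately show ?thesis
      using xy by blast
  qed
  then obtain x y q0 where xy: "x \<in> T" "y \<in> T" "x \<noteq> y" and q0: "q0 \<in> Q" "L q0 x - L q0 y = d x y"
    "\<forall>s\<in>I. \<forall>t\<in>I. s \<le> t \<longrightarrow> L q0 (\<gamma> t) - L q0 (\<gamma> s) = t - s"
    by blast
  have pos: "d x y > 0"
    using xy by simp
  show thesis
  proof (rule that[of q0 x y "1 / d x y"])
    fix q assume "q \<in> Q"
    then show "1 / d x y * (L q x - L q y) \<le> 1"
      using coordinate_diff_le[OF xy(1,2)] pos by simp
  qed (use q0 xy pos in auto)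
qed

text \<open>The prolongation follows the geodesic at the parameter \<open>r t\<close> of the closed
  domain nearest to t and then moves by t - r t along the unit direction. Both \<open>r t\<close>
  and t - r t are nondecreasing and add up to t, so the Lipschitz bounds, and the unit speed of
  \<open>q0\<close>, add up too.\<close>

lemma geodesic_extends:
  assumes geo: "geodesic_on I \<gamma>" and "I \<noteq> {}"
  shows "\<exists>\<gamma>'. geodesic_on UNIV \<gamma>' \<and> (\<forall>t\<in>I. \<gamma>' t = \<gamma> t)"
proof -
  have \<gamma>T: "\<gamma> t \<in> T" if "t \<in> I" for t
    using geo that by (auto simp: geodesic_on_def)
  obtain q0 x y c where q0: "q0 \<in> Q" and xy: "x \<in> T" "y \<in> T"
    and c: "\<And>q. q \<in> Q \<Longrightarrow> c * (L q x - L q y) \<le> 1" "c * (L q0 x - L q0 y) = 1"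
    and supp: "\<And>s t. s \<in> I \<Longrightarrow> t \<in> I \<Longrightarrow> s \<le> t \<Longrightarrow> L q0 (\<gamma> t) - L q0 (\<gamma> s) = t - s"
    using unit_direction[OF assms] by metis
  have lip: "1-lipschitz_on I (\<lambda>t. L q (\<gamma> t))" if "q \<in> Q" for q
  proof (rule lipschitz_onI)
    fix s t assume "s \<in> I" "t \<in> I"
    then show "dist (L q (\<gamma> s)) (L q (\<gamma> t)) \<le> 1 * dist s t"
      using abs_coordinate_diff_le[OF \<gamma>T \<gamma>T \<open>q \<in> Q\<close>, of s t] geo
      by (auto simp: dist_real_def geodesic_on_def)
  qed simp
  then have "\<forall>q\<in>Q. \<exists>g. 1-lipschitz_on (closure I) g \<and> (\<forall>t\<in>I. g t = L q (\<gamma> t))"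
    using lipschitz_extend_closure by blast
  then obtain g where g: "\<And>q. q \<in> Q \<Longrightarrow> 1-lipschitz_on (closure I) (g q)"
      "\<And>q t. q \<in> Q \<Longrightarrow> t \<in> I \<Longrightarrow> g q t = L q (\<gamma> t)"
    by metis
  have g_cont: "continuous_on (closure I) (g q)" if "q \<in> Q" for q
    using g(1)[OF that] by (rule lipschitz_on_continuous_on)
  \<comment> \<open>Lipschitz extension only gives the coordinates of an endpoint;
    \<open>limit\<close> gives a point of T that has them.\<close>
  have g_point: "\<exists>w\<in>T. \<forall>q\<in>Q. L q w = g q t" if t: "t \<in> closure I" for t
  proof -
    obtain u where u: "\<And>n. u n \<in> I" "u \<longlonglongrightarrow> t"
      using t unfolding closure_sequential by blast
    show ?thesis
    proof (rule limit)
      show "\<gamma> (u n) \<in> T" for n using u \<gamma>T by auto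
      fix q assume q: "q \<in> Q"
      have "(\<lambda>n. g q (u n)) \<longlonglongrightarrow> g q t"
        using u(1) closure_subset[of I]
        by (intro continuous_on_tendsto_compose[OF g_cont[OF q] u(2) t] always_eventually) blast
      then show "(\<lambda>n. L q (\<gamma> (u n))) \<longlonglongrightarrow> g q t"
        using g(2)[OF q u(1)] by simp
    qed
  qed
  have g_supp: "g q0 t = g q0 s + (t - s)" if st: "s \<in> closure I" "t \<in> closure I" for s t
  proof -
    obtain i where i: "i \<in> I" using \<open>I \<noteq> {}\<close> by blast
    have A: "continuous_on (closure I) (\<lambda>t. g q0 t - t)"
      using g_cont[OF q0] by (intro continuous_intros)
    have B: "g q0 t - t = g q0 i - i" if "t \<in> I" for t
      using supp[OF that i] supp[OF i that] g(2)[OF q0] i that by (cases "t \<le> i") auto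
    show ?thesis
      using continuous_constant_on_closure[OF A B st(1)] continuous_constant_on_closure[OF A B st(2)]
      by linarith
  qed
  define r where "r = closest_point (closure I)"
  have cI: "convex (closure I)" "closed (closure I)" "closure I \<noteq> {}"
    using geo assms(2) by (auto simp: geodesic_on_def is_interval_convex_1 intro: convex_closure)
  have r_in: "r t \<in> closure I" for t
    unfolding r_def using cI by (intro closest_point_in_set)
  have r_id: "r t = t" if "t \<in> I" for t
    unfolding r_def using that closure_subset by (intro closest_point_self) auto
  \<comment> \<open>If r t < r s, the obtuse angle at the projections gives r s \<le> s and t \<le>
    r t, against s \<le> t.\<close>
  have r_mono: "r s \<le> r t" if "s \<le> t" for s t
  proof (rule ccontr)
    assume "\<not> r s \<le> r t"
    moreover have "(s - r s) * (r t - r s) \<le> 0" "(t - r t) * (r s - r t) \<le> 0"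
      using closest_point_dot[OF cI(1,2) r_in[of t], of s] closest_point_dot[OF cI(1,2) r_in[of s], of t]
      by (auto simp: r_def)
    ultimately have "r s \<le> s" "t \<le> r t"
      by (auto simp: mult_le_0_iff)
    with \<open>\<not> r s \<le> r t\<close> \<open>s \<le> t\<close> show False by linarith
  qed
  have r_lip: "r t - r s \<le> t - s" if "s \<le> t" for s t
    using closest_point_lipschitz[OF cI, of t s] that by (auto simp: r_def dist_real_def)
  have "\<exists>w\<in>T. \<forall>q\<in>Q. L q w = g q (r t) + (t - r t) * (c * (L q x - L q y))" for t
  proof -
    obtain w where w: "w \<in> T" "\<forall>q\<in>Q. L q w = g q (r t)"
      using g_point r_in by blast
    then show ?thesis
      using affine[OF w(1) xy, of "(t - r t) * c"] by (auto simp: mult.assoc)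
  qed
  then obtain \<gamma>' where \<gamma>': "\<And>t. \<gamma>' t \<in> T"
      "\<And>q t. q \<in> Q \<Longrightarrow> L q (\<gamma>' t) = g q (r t) + (t - r t) * (c * (L q x - L q y))"
    by metis
  have "geodesic_on UNIV \<gamma>'"
  proof (rule geodesic_onI[OF _ _ q0])
    fix q and s t :: real assume q: "q \<in> Q" and st: "s \<le> t"
    have "g q (r t) - g q (r s) \<le> r t - r s"
      using lipschitz_onD[OF g(1)[OF q] r_in[of t] r_in[of s]] r_mono[OF st] by (simp add: dist_real_def)
    moreover have "((t - s) - (r t - r s)) * (c * (L q x - L q y)) \<le> ((t - s) - (r t - r s)) * 1"
      using c(1)[OF q] r_lip[OF st] by (intro mult_left_mono) auto
    ultimately show "L q (\<gamma>' t) - L q (\<gamma>' s) \<le> t - s"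
      using \<gamma>'(2)[OF q, of s] \<gamma>'(2)[OF q, of t] by (simp add: algebra_simps)
  next
    fix s t :: real assume st: "s \<le> t"
    show "L q0 (\<gamma>' t) - L q0 (\<gamma>' s) = t - s"
      using \<gamma>'(2)[OF q0] g_supp[OF r_in[of s] r_in[of t]] c(2) by simp
  qed (use \<gamma>' in auto)
  moreover have "\<gamma>' t = \<gamma> t" if "t \<in> I" for t
    using that \<gamma>' \<gamma>T g(2) r_id by (intro sep) auto
  ultimately show ?thesis
    by blast
qed

lemma geodesically_complete: "geodesically_complete"
  unfolding geodesically_complete_def
proof (intro conjI allI impI geodesic_space)
  fix I \<gamma> assume geo: "geodesic_on I \<gamma>"
  show "\<exists>\<gamma>'. geodesic_on UNIV \<gamma>' \<and> (\<forall>t\<in>I. \<gamma>' t = \<gamma> t)"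
  proof (cases "I = {}")
    case True
    obtain x where "x \<in> T" using nontrivial by blast
    \<comment> \<open>A constant geodesic on one parameter stands in for the empty one.\<close>
    then have "geodesic_on {0} (\<lambda>_. x)"
      by (auto simp: geodesic_on_def is_interval_1)
    from geodesic_extends[OF this] show ?thesis
      using True by auto
  qed (use geodesic_extends[OF geo] in blast)
qed

section \<open>The metric topology in terms of the coordinates\<close>

lemma continuous_map_coordinate:
  assumes q: "q \<in> Q"
  shows "continuous_map mtopology euclideanreal (L q)"
proof -
  have "\<exists>U. openin mtopology U \<and> x \<in> U \<and> (\<forall>y\<in>U. L q y \<in> ball (L q x) e)" if "x \<in> T" "e > 0" for x e
  proof (intro exI conjI ballI)
    show "openin mtopology (mball x e)" "x \<in> mball x e"
      using that by auto
    show "L q y \<in> ball (L q x) e" if "y \<in> mball x e" for y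
      using abs_coordinate_diff_le[OF _ _ q, of x y] that by (auto simp: dist_real_def)
  qed
  then show ?thesis
    using Met_TC.continuous_map_to_metric[of mtopology "L q"] by (auto simp: dist_real_def)
qed

text \<open>The distance is attained by one of finitely many coordinate differences, so it is small
  as soon as all coordinates are close, and this is a finite intersection of open
  conditions.\<close>

lemma continuous_map_into_mtopology:
  assumes f: "\<And>x. x \<in> topspace X \<Longrightarrow> f x \<in> T"
    and cont: "\<And>q. q \<in> Q \<Longrightarrow> continuous_map X euclideanreal (\<lambda>x. L q (f x))"
  shows "continuous_map X mtopology f"
  unfolding continuous_map_to_metric
proof (intro ballI allI impI)
  fix x and e :: real assume x: "x \<in> topspace X" and e: "e > 0"
  define U where "U = {y \<in> topspace X. \<forall>q\<in>Q. L q (f y) \<in> ball (L q (f x)) e}"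
  have U: "U = topspace X \<inter> (\<Inter>q\<in>Q. {y \<in> topspace X. L q (f y) \<in> ball (L q (f x)) e})"
    using Q_nonempty by (auto simp: U_def)
  have "openin X U"
    unfolding U using finite_Q Q_nonempty
    by (intro openin_Int openin_topspace openin_Inter) (auto intro!: openin_continuous_map_preimage cont simp del: mem_ball)
  moreover have "f y \<in> mball (f x) e" if "y \<in> U" for y
  proof -
    have y: "y \<in> topspace X" using that by (simp add: U_def)
    obtain q where "q \<in> Q" "L q (f x) - L q (f y) = d (f x) (f y)"
      using dist_attained f x y by blast
    then show ?thesis
      using that f x y by (auto simp: U_def dist_real_def)
  qed
  ultimately show "\<exists>U. openin X U \<and> x \<in> U \<and> (\<forall>y\<in>U. f y \<in> mball (f x) e)"
    using x e by (intro exI[of _ U]) (auto simp: U_def)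
qed

end

section \<open>Moebius classes as logarithmic edge weights\<close>

text \<open>Weights are functions of sets, which builds in symmetry; a quadruple of distinct points
  evaluates them at two-element sets only.\<close>

fun log_cross_ratio :: "('a set \<Rightarrow> real) \<Rightarrow> 'a \<times> 'a \<times> 'a \<times> 'a \<Rightarrow> real" where
  "log_cross_ratio v (\<xi>, \<xi>', \<eta>, \<eta>') = v {\<xi>, \<eta>} + v {\<xi>', \<eta>'} - v {\<xi>, \<eta>'} - v {\<xi>', \<eta>}"

lemma log_cross_ratio_affine:
  "log_cross_ratio (\<lambda>e. u e + c * (v e - w e)) q =
     log_cross_ratio u q + c * (log_cross_ratio v q - log_cross_ratio w q)"
  by (cases q) (simp add: algebra_simps)

lemma finite_quads:
  assumes "finite Z"
  shows "finite (quads Z)"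
  by (rule finite_subset[of _ "Z \<times> Z \<times> Z \<times> Z"]) (use assms in \<open>auto simp: quads_def\<close>)

text \<open>
  The points of \<open>S\<close> are made tight one at a time by lowering their potential as far as possible.
  This keeps earlier points tight: the constraint that is an equality at an earlier point prevents
  its partner from being lowered.
\<close>

lemma tight_potential:
  fixes v :: "'a set \<Rightarrow> real"
  assumes "finite Z" "2 \<le> card Z" "S \<subseteq> Z"
  shows "\<exists>f. (\<forall>\<xi>\<in>Z. \<forall>\<eta>\<in>Z - {\<xi>}. v {\<xi>, \<eta>} \<le> f \<xi> + f \<eta>) \<and>
    (\<forall>\<xi>\<in>S. \<exists>\<eta>\<in>Z - {\<xi>}. v {\<xi>, \<eta>} = f \<xi> + f \<eta>)"
proof -
  have "finite S" using assms finite_subset by blast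
  then show ?thesis using \<open>S \<subseteq> Z\<close>
  proof (induction S)
    case empty
    \<comment> \<open>Half of the largest value of v, placed at every point, dominates every
      edge.\<close>
    define c where "c = Max (v ` Pow Z) / 2"
    have "v {\<xi>, \<eta>} \<le> c + c" if "\<xi> \<in> Z" "\<eta> \<in> Z" for \<xi> \<eta>
      using that assms(1) by (auto simp: c_def intro!: Max_ge)
    then show ?case
      by (intro exI[of _ "\<lambda>_. c"]) auto
  next
    case (insert x S)
    then obtain f where f: "\<And>\<xi> \<eta>. \<xi> \<in> Z \<Longrightarrow> \<eta> \<in> Z - {\<xi>} \<Longrightarrow> v {\<xi>, \<eta>} \<le> f \<xi> + f \<eta>"
      and tight: "\<And>\<xi>. \<xi> \<in> S \<Longrightarrow> \<exists>\<eta>\<in>Z - {\<xi>}. v {\<xi>, \<eta>} = f \<xi> + f \<eta>"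
      by (auto; blast)
    \<comment> \<open>\<open>Max A\<close> is the least potential at x that the constraints at x
      allow.\<close>
    define A where "A = (\<lambda>\<eta>. v {x, \<eta>} - f \<eta>) ` (Z - {x})"
    define g where "g = f(x := Max A)"
    have xZ: "x \<in> Z" using insert by auto
    have "Z - {x} \<noteq> {}"
      using assms(1,2) xZ by (metis card_Diff_singleton card.empty diff_is_0_eq not_less_eq_eq numeral_2_eq_2 One_nat_def)
    then have A: "finite A" "A \<noteq> {}"
      using assms(1) by (auto simp: A_def)
    have ge: "v {x, \<eta>} \<le> Max A + f \<eta>" if "\<eta> \<in> Z - {x}" for \<eta>
    proof -
      have "v {x, \<eta>} - f \<eta> \<le> Max A"
        using that A by (intro Max_ge) (auto simp: A_def)
      then show ?thesis by simp
    qed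
    have "\<exists>\<eta>\<in>Z - {x}. v {x, \<eta>} = a + f \<eta>" if a: "a \<in> A" for a
    proof -
      obtain \<eta> where "\<eta> \<in> Z - {x}" "a = v {x, \<eta>} - f \<eta>"
        using a unfolding A_def by blast
      then show ?thesis by (intro bexI[of _ \<eta>]) auto
    qed
    from this[OF Max_in[OF A]]
    obtain \<eta>0 where \<eta>0: "\<eta>0 \<in> Z - {x}" "v {x, \<eta>0} = Max A + f \<eta>0"
      by blast
    have le: "Max A \<le> f x"
      using \<eta>0 f[OF xZ \<eta>0(1)] by simp
    have "v {\<xi>, \<eta>} \<le> g \<xi> + g \<eta>" if "\<xi> \<in> Z" "\<eta> \<in> Z - {\<xi>}" for \<xi> \<eta>
      using ge[of \<xi>] ge[of \<eta>] f[of \<xi> \<eta>] that by (auto simp: g_def insert_commute add.commute)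
    moreover have "\<exists>\<eta>\<in>Z - {\<xi>}. v {\<xi>, \<eta>} = g \<xi> + g \<eta>" if "\<xi> \<in> insert x S" for \<xi>
    proof (cases "\<xi> = x")
      case True
      then show ?thesis using \<eta>0 by (auto simp: g_def)
    next
      case False
      then obtain \<eta> where \<eta>: "\<eta> \<in> Z - {\<xi>}" "v {\<xi>, \<eta>} = f \<xi> + f \<eta>"
        using tight \<open>\<xi> \<in> insert x S\<close> by blast
      have "Max A = f x" if "\<eta> = x"
        using ge[of \<xi>] le \<eta> that False \<open>\<xi> \<in> insert x S\<close> insert.prems by (auto simp: insert_commute)
      then show ?thesis
        using \<eta> False by (intro bexI[of _ \<eta>]) (auto simp: g_def)
    qed
    ultimately show ?case
      by (intro exI[of _ g] conjI ballI)
  qed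
qed

text \<open>Subtracting a tight potential leaves cross-ratios alone, since each point occurs once in
  the numerator and once in the denominator. After exponentiation, domination bounds all values by 1
  and tightness gives every point a partner with value 1.\<close>

lemma antipodal_realisation:
  fixes v :: "'a set \<Rightarrow> real"
  assumes "finite Z" "2 \<le> card Z"
  shows "\<exists>\<rho>\<in>antipodal_functions Z. \<forall>q\<in>quads Z. ln (cross_ratio \<rho> q) = log_cross_ratio v q"
proof -
  obtain f where "(\<forall>\<xi>\<in>Z. \<forall>\<eta>\<in>Z - {\<xi>}. v {\<xi>, \<eta>} \<le> f \<xi> + f \<eta>) \<and>
      (\<forall>\<xi>\<in>Z. \<exists>\<eta>\<in>Z - {\<xi>}. v {\<xi>, \<eta>} = f \<xi> + f \<eta>)"
    using tight_potential[OF assms subset_refl] by (rule exE)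
  then have f: "\<And>\<xi> \<eta>. \<xi> \<in> Z \<Longrightarrow> \<eta> \<in> Z - {\<xi>} \<Longrightarrow> v {\<xi>, \<eta>} \<le> f \<xi> + f \<eta>"
      and tight: "\<And>\<xi>. \<xi> \<in> Z \<Longrightarrow> \<exists>\<eta>\<in>Z - {\<xi>}. v {\<xi>, \<eta>} = f \<xi> + f \<eta>"
    by simp_all
  define \<rho> where "\<rho> = restrict (\<lambda>(\<xi>, \<eta>). if \<xi> = \<eta> then 0 else exp (v {\<xi>, \<eta>} - f \<xi> - f \<eta>)) (Z \<times> Z)"
  have \<rho>: "\<rho> (\<xi>, \<eta>) = (if \<xi> = \<eta> then 0 else exp (v {\<xi>, \<eta>} - f \<xi> - f \<eta>))" if "\<xi> \<in> Z" "\<eta> \<in> Z" for \<xi> \<eta>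
    using that by (simp add: \<rho>_def)
  have one: "\<exists>\<eta>\<in>Z. \<rho> (\<xi>, \<eta>) = 1" if \<xi>: "\<xi> \<in> Z" for \<xi>
  proof -
    obtain \<eta> where "\<eta> \<in> Z - {\<xi>}" "v {\<xi>, \<eta>} = f \<xi> + f \<eta>"
      using tight[OF \<xi>] by blast
    then show ?thesis
      using \<rho>[OF \<xi>, of \<eta>] by (intro bexI[of _ \<eta>]) auto
  qed
  have "Z \<noteq> {}" using assms by auto
  then obtain \<xi> \<eta> where "\<xi> \<in> Z" "\<eta> \<in> Z" "\<rho> (\<xi>, \<eta>) = 1"
    using one by blast
  then have "1 \<in> \<rho> ` (Z \<times> Z)"
    by (metis SigmaI imageI)
  moreover have "\<rho> (\<xi>, \<eta>) \<le> 1" if "\<xi> \<in> Z" "\<eta> \<in> Z" for \<xi> \<eta>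
  proof (cases "\<xi> = \<eta>")
    case False
    then have "v {\<xi>, \<eta>} - f \<xi> - f \<eta> \<le> 0"
      using f[of \<xi> \<eta>] that by simp
    then show ?thesis
      using \<rho>[OF that] False by simp
  qed (simp add: \<rho> that)
  then have "y \<le> 1" if "y \<in> \<rho> ` (Z \<times> Z)" for y
    using that by blast
  ultimately have "Max (\<rho> ` (Z \<times> Z)) = 1"
    using assms(1) by (intro Max_eqI finite_imageI finite_cartesian_product)
  moreover have "separating Z \<rho>"
    unfolding separating_def
  proof (intro conjI ballI)
    show "\<rho> \<in> Z \<times> Z \<rightarrow>\<^sub>E {0..}"
      by (auto simp: \<rho>_def)
    fix \<xi> \<eta> assume Z: "\<xi> \<in> Z" "\<eta> \<in> Z"
    show "\<rho> (\<xi>, \<eta>) = \<rho> (\<eta>, \<xi>)"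
      using \<rho>[OF Z] \<rho>[OF Z(2,1)] by (simp add: insert_commute[of \<eta> \<xi>])
    show "\<rho> (\<xi>, \<eta>) = 0 \<longleftrightarrow> \<xi> = \<eta>"
      using \<rho>[OF Z] by simp
  qed
  ultimately have "\<rho> \<in> antipodal_functions Z"
    using one by (simp add: antipodal_functions_def)
  moreover have "ln (cross_ratio \<rho> q) = log_cross_ratio v q" if "q \<in> quads Z" for q
    using that by (cases q) (simp add: quads_def \<rho> ln_div ln_mult)
  ultimately show ?thesis
    by blast
qed

text \<open>Passes from ordered pairs to edges; for a separating function on Z, all candidates at an
  edge in Z have the same value.\<close>

definition edge_log :: "('a \<times> 'a \<Rightarrow> real) \<Rightarrow> 'a set \<Rightarrow> real" where
  "edge_log \<rho> e = ln (SOME r. \<exists>\<xi> \<eta>. e = {\<xi>, \<eta>} \<and> r = \<rho> (\<xi>, \<eta>))"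

lemma edge_log:
  assumes "separating Z \<rho>" "\<xi> \<in> Z" "\<eta> \<in> Z"
  shows "edge_log \<rho> {\<xi>, \<eta>} = ln (\<rho> (\<xi>, \<eta>))"
proof -
  have "(SOME r. \<exists>\<xi>' \<eta>'. {\<xi>, \<eta>} = {\<xi>', \<eta>'} \<and> r = \<rho> (\<xi>', \<eta>')) = \<rho> (\<xi>, \<eta>)"
    by (rule some_equality) (use assms in \<open>auto simp: doubleton_eq_iff separating_def\<close>)
  then show ?thesis
    by (simp add: edge_log_def)
qed

lemma separating_pos:
  assumes "separating Z \<rho>" "\<xi> \<in> Z" "\<eta> \<in> Z" "\<xi> \<noteq> \<eta>"
  shows "\<rho> (\<xi>, \<eta>) > 0"
proof -
  have "\<rho> (\<xi>, \<eta>) \<in> {0..}" "\<rho> (\<xi>, \<eta>) \<noteq> 0"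
    using assms by (auto simp: separating_def)
  then show ?thesis by simp
qed

lemma cross_ratio_pos:
  assumes "separating Z \<rho>" "q \<in> quads Z"
  shows "cross_ratio \<rho> q > 0"
  using assms by (cases q) (auto simp: quads_def intro!: divide_pos_pos mult_pos_pos separating_pos)

lemma ln_cross_ratio:
  assumes "separating Z \<rho>" "q \<in> quads Z"
  shows "ln (cross_ratio \<rho> q) = log_cross_ratio (edge_log \<rho>) q"
proof -
  obtain a b c e where q: "q = (a, b, c, e)" by (cases q)
  have "\<rho> (a, c) > 0" "\<rho> (b, e) > 0" "\<rho> (a, e) > 0" "\<rho> (b, c) > 0"
    using assms by (auto simp: q quads_def intro!: separating_pos)
  then show ?thesis
    using assms by (simp add: q quads_def edge_log ln_div ln_mult)
qed

text \<open>This weight depends on the chosen representative; only combinations blind to potentials,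
  such as \<open>log_cross_ratio\<close>, belong to the class.\<close>

definition class_weight :: "('a \<times> 'a \<Rightarrow> real) set \<Rightarrow> 'a set \<Rightarrow> real" where
  "class_weight C = edge_log (SOME \<rho>. \<rho> \<in> C)"

lemma class_representative:
  assumes "C \<in> big_teichmuller Z"
  shows "\<exists>\<rho>\<in>antipodal_functions Z. C = moebius_class Z \<rho> \<and> class_weight C = edge_log \<rho>"
proof -
  define \<rho> where "\<rho> = (SOME \<rho>. \<rho> \<in> C)"
  obtain \<rho>' where \<rho>': "\<rho>' \<in> antipodal_functions Z" "C = moebius_class Z \<rho>'"
    using assms by (auto simp: big_teichmuller_def quotient_def moebius_class_def)
  then have "\<rho>' \<in> C"
    by (auto simp: moebius_class_def moebius_rel_def moebius_equiv_def)
  then have "\<rho> \<in> C"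
    unfolding \<rho>_def by (rule someI[of "\<lambda>\<rho>. \<rho> \<in> C"])
  then have "(\<rho>', \<rho>) \<in> moebius_rel Z"
    by (simp add: \<rho>' moebius_class_def)
  then have "\<rho> \<in> antipodal_functions Z \<and> C = moebius_class Z \<rho>"
    using equiv_class_eq[OF equiv_moebius_rel] \<rho>' by (auto simp: moebius_class_def moebius_rel_def)
  moreover have "class_weight C = edge_log \<rho>"
    by (simp add: class_weight_def \<rho>_def)
  ultimately show ?thesis
    by blast
qed

lemma log_cross_ratio_class:
  assumes "\<rho> \<in> antipodal_functions Z" "q \<in> quads Z"
  shows "log_cross_ratio (class_weight (moebius_class Z \<rho>)) q = ln (cross_ratio \<rho> q)"
proof -
  have "moebius_class Z \<rho> \<in> big_teichmuller Z"
    using assms by (auto simp: moebius_class_def big_teichmuller_def intro: quotientI)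
  then obtain \<rho>' where \<rho>': "\<rho>' \<in> antipodal_functions Z" "moebius_class Z \<rho> = moebius_class Z \<rho>'"
    "class_weight (moebius_class Z \<rho>) = edge_log \<rho>'"
    using class_representative by blast
  then have "moebius_equiv Z \<rho> \<rho>'"
    using eq_equiv_class[OF _ equiv_moebius_rel] assms(1)
    by (metis (mono_tags, lifting) CollectD case_prodD moebius_class_def moebius_rel_def)
  then have "cross_ratio \<rho> q = cross_ratio \<rho>' q"
    using assms(2) by (simp add: moebius_equiv_def)
  then show ?thesis
    using ln_cross_ratio[OF _ assms(2), of \<rho>'] \<rho>'(1,3) by (simp add: antipodal_functions_def)
qed

text \<open>As v is arbitrary, the coordinate vectors of classes form a linear space;
  \<open>affine\<close> and \<open>limit\<close> rest on this.\<close>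

lemma class_realisation:
  fixes v :: "'a set \<Rightarrow> real"
  assumes "finite Z" "2 \<le> card Z"
  shows "\<exists>C\<in>big_teichmuller Z. \<forall>q\<in>quads Z. log_cross_ratio (class_weight C) q = log_cross_ratio v q"
proof -
  obtain \<rho> where \<rho>: "\<rho> \<in> antipodal_functions Z" "\<forall>q\<in>quads Z. ln (cross_ratio \<rho> q) = log_cross_ratio v q"
    using antipodal_realisation[OF assms] by blast
  moreover have "moebius_class Z \<rho> \<in> big_teichmuller Z"
    using \<rho> by (auto simp: moebius_class_def big_teichmuller_def intro: quotientI)
  ultimately show ?thesis
    by (metis log_cross_ratio_class)
qed

lemma class_eqI:
  assumes "C \<in> big_teichmuller Z" "C' \<in> big_teichmuller Z"
    and eq: "\<And>q. q \<in> quads Z \<Longrightarrow> log_cross_ratio (class_weight C) q = log_cross_ratio (class_weight C') q"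
  shows "C = C'"
proof -
  obtain \<rho> \<rho>' where \<rho>: "\<rho> \<in> antipodal_functions Z" "C = moebius_class Z \<rho>"
    and \<rho>': "\<rho>' \<in> antipodal_functions Z" "C' = moebius_class Z \<rho>'"
    using class_representative assms(1,2) by metis
  have sep: "separating Z \<rho>" "separating Z \<rho>'"
    using \<rho> \<rho>' by (auto simp: antipodal_functions_def)
  have "cross_ratio \<rho> q = cross_ratio \<rho>' q" if "q \<in> quads Z" for q
    using eq[OF that] log_cross_ratio_class[OF _ that] \<rho> \<rho>'
      cross_ratio_pos[OF sep(1) that] cross_ratio_pos[OF sep(2) that]
    by simp
  then have "(\<rho>, \<rho>') \<in> moebius_rel Z"
    using \<rho> \<rho>' by (simp add: moebius_rel_def moebius_equiv_def)
  then show ?thesis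
    using equiv_class_eq[OF equiv_moebius_rel] \<rho> \<rho>' by (simp add: moebius_class_def)
qed

lemma moebius_dist_eq:
  assumes "C \<in> big_teichmuller Z" "C' \<in> big_teichmuller Z"
  shows "moebius_dist Z C C' =
    (SUP q\<in>quads Z. log_cross_ratio (class_weight C) q - log_cross_ratio (class_weight C') q)"
proof -
  obtain \<rho> \<rho>' where \<rho>: "\<rho> \<in> antipodal_functions Z" "C = moebius_class Z \<rho>"
    and \<rho>': "\<rho>' \<in> antipodal_functions Z" "C' = moebius_class Z \<rho>'"
    using class_representative assms(1,2) by metis
  have sep: "separating Z \<rho>" "separating Z \<rho>'"
    using \<rho> \<rho>' by (auto simp: antipodal_functions_def)
  have "ln (cross_ratio \<rho> q / cross_ratio \<rho>' q) =
      log_cross_ratio (class_weight C) q - log_cross_ratio (class_weight C') q" if "q \<in> quads Z" for q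
    using cross_ratio_pos[OF sep(1) that] cross_ratio_pos[OF sep(2) that]
      log_cross_ratio_class[OF \<rho>(1) that] log_cross_ratio_class[OF \<rho>'(1) that]
    by (simp add: \<rho>(2) \<rho>'(2) ln_div)
  then show ?thesis
    unfolding \<rho>(2) \<rho>'(2) moebius_dist_class[OF \<rho>(1) \<rho>'(1)] by (intro SUP_cong refl)
qed

section \<open>Coordinates relative to a base point\<close>

text \<open>
  Rescaling a separating function so that it is \<open>1\<close> on all edges at the base point \<open>z\<close> leaves the
  edges of \<open>Z - {z}\<close> as coordinates, and a Moebius class determines these up to a common factor.
\<close>

definition edges :: "'a set \<Rightarrow> 'a set set" where
  "edges A = {e. e \<subseteq> A \<and> card e = 2}"

definition based_weight :: "'a \<Rightarrow> ('a set \<Rightarrow> real) \<Rightarrow> 'a set \<Rightarrow> real" where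
  "based_weight z v e = v e - (\<Sum>i\<in>e. v {z, i})"

definition extend_by_zero :: "'a \<Rightarrow> ('a set \<Rightarrow> real) \<Rightarrow> 'a set \<Rightarrow> real" where
  "extend_by_zero z u e = (if z \<in> e then 0 else u e)"

lemma doubleton_in_edges [simp]: "i \<noteq> j \<Longrightarrow> {i, j} \<in> edges A \<longleftrightarrow> i \<in> A \<and> j \<in> A"
  by (auto simp: edges_def)

lemma edgesE:
  assumes "e \<in> edges A"
  obtains i j where "e = {i, j}" "i \<noteq> j" "i \<in> A" "j \<in> A"
  using assms by (auto simp: edges_def card_2_iff)

lemma finite_edges: "finite A \<Longrightarrow> finite (edges A)"
  unfolding edges_def by (rule finite_subset[of _ "Pow A"]) auto

text \<open>On the edges of Z the new weight is v minus the potential with value v {z, i} + c/2 at i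
  \<noteq> z and -c/2 at z. Hence also the common shift c is invisible to cross-ratios.\<close>

lemma log_cross_ratio_extend_by_zero:
  assumes "q \<in> quads Z" and u: "\<And>e. e \<in> edges (Z - {z}) \<Longrightarrow> u e = based_weight z v e - c"
  shows "log_cross_ratio (extend_by_zero z u) q = log_cross_ratio v q"
proof -
  have *: "extend_by_zero z u {i, j} = v {i, j} - (if z = i \<or> z = j then v {i, j} else v {z, i} + v {z, j} + c)"
    if "i \<in> Z" "j \<in> Z" "i \<noteq> j" for i j
    using that u[of "{i, j}"] by (auto simp: extend_by_zero_def based_weight_def)
  obtain a b c e where q: "q = (a, b, c, e)" by (cases q)
  then have "a \<in> Z" "b \<in> Z" "c \<in> Z" "e \<in> Z" "a \<noteq> c" "a \<noteq> e" "b \<noteq> c" "b \<noteq> e" "a \<noteq> b" "c \<noteq> e"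
    using assms(1) by (auto simp: quads_def)
  then show ?thesis
    by (auto simp: q * insert_commute)
qed

text \<open>Two edges {i, j} and {i, k} differ by the single log cross-ratio of
  \<open>(i, z, j, k)\<close>, and any two edges are linked through at most one intermediate edge.
  The coefficients do not depend on v, so continuity and limits pass from cross-ratios to these
  differences.\<close>

lemma based_weight_diff:
  assumes Z: "finite Z" "z \<in> Z" and e: "e \<in> edges (Z - {z})" "e' \<in> edges (Z - {z})"
  shows "\<exists>c. \<forall>v. based_weight z v e - based_weight z v e' = (\<Sum>q\<in>quads Z. c q * log_cross_ratio v q)"
proof -
  define P where "P e e' \<longleftrightarrow> (\<exists>c. \<forall>v. based_weight z v e - based_weight z v e' =
      (\<Sum>q\<in>quads Z. c q * log_cross_ratio v q))" for e e'
  have trans: "P e e''" if ee': "P e e'" "P e' e''" for e e' e''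
  proof -
    obtain c c' where c: "\<And>v. based_weight z v e - based_weight z v e' = (\<Sum>q\<in>quads Z. c q * log_cross_ratio v q)"
      "\<And>v. based_weight z v e' - based_weight z v e'' = (\<Sum>q\<in>quads Z. c' q * log_cross_ratio v q)"
      using ee' unfolding P_def by blast
    have "based_weight z v e - based_weight z v e'' = (\<Sum>q\<in>quads Z. (c q + c' q) * log_cross_ratio v q)" for v
      using c(1)[of v] c(2)[of v] by (simp add: distrib_right sum.distrib)
    then show ?thesis unfolding P_def by (intro exI[of _ "\<lambda>q. c q + c' q"]) blast
  qed
  have step: "P {i, j} {i, k}" if "i \<in> Z - {z}" "j \<in> Z - {z}" "k \<in> Z - {z}" "i \<noteq> j" "i \<noteq> k" for i j k
  proof (cases "j = k")
    case True
    then show ?thesis unfolding P_def by (intro exI[of _ "\<lambda>_. 0"]) simp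
  next
    case False
    define q where "q = (i, z, j, k)"
    have "q \<in> quads Z" using that False Z by (auto simp: q_def quads_def)
    have "based_weight z v {i, j} - based_weight z v {i, k} = (\<Sum>p\<in>quads Z. of_bool (p = q) * log_cross_ratio v p)" for v
    proof -
      have "(\<Sum>p\<in>quads Z. of_bool (p = q) * log_cross_ratio v p) = (\<Sum>p\<in>{q}. log_cross_ratio v p)"
        using \<open>q \<in> quads Z\<close> finite_quads[OF Z(1)] by (intro sum.mono_neutral_cong_right) auto
      then show ?thesis
        using that by (simp add: q_def based_weight_def)
    qed
    then show ?thesis unfolding P_def by (intro exI[of _ "\<lambda>p. of_bool (p = q)"]) blast
  qed
  obtain i j where ij: "e = {i, j}" "i \<noteq> j" "i \<in> Z - {z}" "j \<in> Z - {z}"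
    using e(1) by (rule edgesE)
  obtain k l where kl: "e' = {k, l}" "k \<noteq> l" "k \<in> Z - {z}" "l \<in> Z - {z}"
    using e(2) by (rule edgesE)
  have "P e e'"
  proof (cases "k = i")
    case True
    then show ?thesis using step[of i j l] ij kl by simp
  next
    case False
    then have "P {i, j} {i, k}" "P {i, k} {k, l}"
      using step[of i j k] step[of k i l] ij kl by (auto simp: insert_commute[of i k])
    then show ?thesis
      unfolding ij(1) kl(1) by (rule trans)
  qed
  then show ?thesis by (simp add: P_def)
qed

lemma based_weight_diff_cong:
  assumes Z: "finite Z" "z \<in> Z" and e: "e \<in> edges (Z - {z})" "e' \<in> edges (Z - {z})"
    and "\<And>q. q \<in> quads Z \<Longrightarrow> log_cross_ratio v q = log_cross_ratio w q"
  shows "based_weight z v e - based_weight z v e' = based_weight z w e - based_weight z w e'"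
proof -
  obtain c where c: "\<And>v. based_weight z v e - based_weight z v e' = (\<Sum>q\<in>quads Z. c q * log_cross_ratio v q)"
    using based_weight_diff[OF Z e] by blast
  show ?thesis
    unfolding c using assms(5) by (intro sum.cong) auto
qed

text \<open>Convergent cross-ratios do not make the weights converge, as these may drift by
  potentials. Basing at z and subtracting the value at one edge removes this freedom.\<close>

lemma log_cross_ratio_limit:
  fixes w :: "nat \<Rightarrow> 'a set \<Rightarrow> real"
  assumes Z: "finite Z" and lim: "\<And>q. q \<in> quads Z \<Longrightarrow> (\<lambda>n. log_cross_ratio (w n) q) \<longlonglongrightarrow> l q"
  shows "\<exists>v. \<forall>q\<in>quads Z. log_cross_ratio v q = l q"
proof (cases "quads Z = {}")
  case False
  then obtain z b1 b2 b3 where q: "(z, b1, b2, b3) \<in> quads Z" by auto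
  then have z: "z \<in> Z" and f: "{b1, b2} \<in> edges (Z - {z})"
    by (auto simp: quads_def)
  define W where "W n e = based_weight z (w n) e - based_weight z (w n) {b1, b2}" for n e
  have "\<exists>u. (\<lambda>n. W n e) \<longlonglongrightarrow> u" if e: "e \<in> edges (Z - {z})" for e
  proof -
    obtain c where c: "\<And>v. based_weight z v e - based_weight z v {b1, b2} = (\<Sum>q\<in>quads Z. c q * log_cross_ratio v q)"
      using based_weight_diff[OF Z z e f] by blast
    have "(\<lambda>n. W n e) \<longlonglongrightarrow> (\<Sum>q\<in>quads Z. c q * l q)"
      unfolding W_def c by (intro tendsto_intros lim)
    then show ?thesis by blast
  qed
  then obtain u where u: "\<And>e. e \<in> edges (Z - {z}) \<Longrightarrow> (\<lambda>n. W n e) \<longlonglongrightarrow> u e"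
    by metis
  have "log_cross_ratio (extend_by_zero z u) q = l q" if q: "q \<in> quads Z" for q
  proof -
    have *: "(\<lambda>n. extend_by_zero z (W n) {i, j}) \<longlonglongrightarrow> extend_by_zero z u {i, j}"
      if "i \<in> Z" "j \<in> Z" "i \<noteq> j" for i j
      using u[of "{i, j}"] that by (auto simp: extend_by_zero_def)
    have "(\<lambda>n. log_cross_ratio (extend_by_zero z (W n)) q) \<longlonglongrightarrow> log_cross_ratio (extend_by_zero z u) q"
      using q by (cases q) (auto simp: quads_def intro!: tendsto_intros *)
    moreover have "log_cross_ratio (extend_by_zero z (W n)) q = log_cross_ratio (w n) q" for n
      using q by (rule log_cross_ratio_extend_by_zero) (simp add: W_def)
    ultimately show ?thesis
      using lim[OF q] LIMSEQ_unique by force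
  qed
  then show ?thesis by blast
qed auto

lemma coordinate_metric_big_teichmuller:
  fixes Z :: "'a set"
  assumes Z: "finite Z" "card Z \<ge> 4"
  shows "coordinate_metric (big_teichmuller Z) (quads Z) (\<lambda>q C. log_cross_ratio (class_weight C) q)
    (moebius_dist Z)"
proof
  show "finite (quads Z)" by (rule finite_quads[OF Z(1)])
  fix q assume q: "q \<in> quads Z"
  obtain a b c e where abce: "q = (a, b, c, e)" by (cases q)
  \<comment> \<open>Exchanging the last two points inverts the cross-ratio.\<close>
  then have "(a, b, e, c) \<in> quads Z"
    using q by (auto simp: quads_def)
  then show "\<exists>q'\<in>quads Z. \<forall>C\<in>big_teichmuller Z.
      log_cross_ratio (class_weight C) q' = - log_cross_ratio (class_weight C) q"
    by (rule bexI[rotated]) (simp add: abce)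
next
  fix C C'
  assume "C \<in> big_teichmuller Z" "C' \<in> big_teichmuller Z"
    "\<And>q. q \<in> quads Z \<Longrightarrow> log_cross_ratio (class_weight C) q = log_cross_ratio (class_weight C') q"
  then show "C = C'" by (rule class_eqI)
next
  fix C1 C2 C3 c
  have "2 \<le> card Z" using Z by simp
  from class_realisation[OF Z(1) this,
      of "\<lambda>e. class_weight C1 e + c * (class_weight C2 e - class_weight C3 e)"]
  show "\<exists>w\<in>big_teichmuller Z. \<forall>q\<in>quads Z. log_cross_ratio (class_weight w) q =
      log_cross_ratio (class_weight C1) q +
      c * (log_cross_ratio (class_weight C2) q - log_cross_ratio (class_weight C3) q)"
    by (simp add: log_cross_ratio_affine)
next
  fix X :: "nat \<Rightarrow> ('a \<times> 'a \<Rightarrow> real) set" and l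
  assume "\<And>q. q \<in> quads Z \<Longrightarrow> (\<lambda>n. log_cross_ratio (class_weight (X n)) q) \<longlonglongrightarrow> l q"
  then obtain v where "\<forall>q\<in>quads Z. log_cross_ratio v q = l q"
    using log_cross_ratio_limit[OF Z(1), of "\<lambda>n. class_weight (X n)" l] by blast
  then show "\<exists>C\<in>big_teichmuller Z. \<forall>q\<in>quads Z. log_cross_ratio (class_weight C) q = l q"
    using class_realisation[OF Z(1), of v] Z(2) by simp
next
  \<comment> \<open>Four points carry a cross-ratio that separates two classes: the weight of the
    single edge {a, c} gives 1 at (a, b, c, e), the zero weight gives 0.\<close>
  obtain A where A: "A \<subseteq> Z" "card A = 4"
    using Z(2) by (meson obtain_subset_with_card_n)
  then obtain a b c e where abce: "A = {a, b, c, e}" "distinct [a, b, c, e]"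
    by (auto simp: card_Suc_eq numeral_eq_Suc)
  have q: "(a, b, c, e) \<in> quads Z"
    using A(1) abce by (auto simp: quads_def)
  have Z2: "2 \<le> card Z" using Z by simp
  obtain C where C: "C \<in> big_teichmuller Z"
    "\<forall>q\<in>quads Z. log_cross_ratio (class_weight C) q = log_cross_ratio (\<lambda>x. of_bool (x = {a, c})) q"
    using class_realisation[OF Z(1) Z2] by blast
  obtain C' where C': "C' \<in> big_teichmuller Z"
    "\<forall>q\<in>quads Z. log_cross_ratio (class_weight C') q = log_cross_ratio (\<lambda>x. 0) q"
    using class_realisation[OF Z(1) Z2] by blast
  have "log_cross_ratio (class_weight C) (a, b, c, e) \<noteq> log_cross_ratio (class_weight C') (a, b, c, e)"
    using C(2) C'(2) q abce(2) by (auto simp: doubleton_eq_iff simp del: log_cross_ratio.simps) (auto simp: doubleton_eq_iff)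
  then have "C \<noteq> C'" by blast
  then show "\<exists>x\<in>big_teichmuller Z. \<exists>y\<in>big_teichmuller Z. x \<noteq> y"
    using C(1) C'(1) by blast
next
  fix C C' assume "C \<in> big_teichmuller Z" "C' \<in> big_teichmuller Z"
  then show "moebius_dist Z C C' =
      (SUP q\<in>quads Z. log_cross_ratio (class_weight C) q - log_cross_ratio (class_weight C') q)"
    by (rule moebius_dist_eq)
next
  fix C C' assume "\<not> (C \<in> big_teichmuller Z \<and> C' \<in> big_teichmuller Z)"
  then show "moebius_dist Z C C' = 0"
    by (auto simp: moebius_dist_def)
qed

section \<open>The homeomorphism with the open simplex\<close>

lemma card_edges: "finite A \<Longrightarrow> card (edges A) = card A choose 2"
  unfolding edges_def by (rule n_subsets)

text \<open>The left side counts the edges that avoid the base point, the right side the coordinates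
  of the simplex.\<close>

lemma choose_two_eq_simplex_dim:
  assumes "m \<ge> 3"
  shows "(m - 1) choose 2 = 1 + m * (m - 3) div 2"
proof -
  obtain k where k: "m = k + 3"
    using assms by (metis add.commute le_Suc_ex)
  have "(k + 2) * (k + 1) = 2 + (k + 3) * k"
    by (simp add: algebra_simps)
  then have "(k + 2) * (k + 1) div 2 = 1 + (k + 3) * k div 2"
    by simp
  then show ?thesis
    by (simp add: k choose_two)
qed

lemma topspace_open_simplex:
  "topspace (subtopology (Euclidean_space (1 + p)) (open_simplex p)) = open_simplex p"
  by (auto simp: open_simplex_def)

lemma continuous_map_simplex_projection:
  "continuous_map (subtopology (Euclidean_space (1 + p)) (open_simplex p)) euclideanreal (\<lambda>x. x k)"
  unfolding Euclidean_space_def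
  by (intro continuous_map_from_subtopology continuous_map_product_projection) simp

text \<open>One map exponentiates the based weights and normalises their sum to 1; its inverse takes
  logarithms. The factor lost in normalising is the one that a class leaves undetermined.\<close>

lemma homeomorphic_open_simplex:
  fixes Z :: "'a set"
  assumes Z: "finite Z" "card Z \<ge> 4" and p: "card (edges (Z - {z})) = 1 + p" "z \<in> Z"
  shows "Metric_space.mtopology (big_teichmuller Z) (moebius_dist Z) homeomorphic_space
    subtopology (Euclidean_space (1 + p)) (open_simplex p)"
proof -
  interpret coordinate_metric "big_teichmuller Z" "quads Z" "\<lambda>q C. log_cross_ratio (class_weight C) q"
      "moebius_dist Z"
    using coordinate_metric_big_teichmuller[OF Z] .
  define n where "n = 1 + p"
  define E where "E = edges (Z - {z})"
  define S where "S = subtopology (Euclidean_space n) (open_simplex p)"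
  have n: "card E = n" "finite E" "n > 0"
    using p Z by (auto simp: E_def n_def finite_edges)
  obtain b where b: "bij_betw b {..<n} E"
    using ex_bij_betw_nat_finite[OF n(2)] n(1) by (auto simp: atLeast0LessThan)
  define idx where "idx = inv_into {..<n} b"
  have bE: "b i \<in> E" if "i < n" for i
    using b that by (auto simp: bij_betw_def)
  have idx: "idx e < n" "b (idx e) = e" if "e \<in> E" for e
    using bij_betw_inv_into_right[OF b that] bij_betw_apply[OF bij_betw_inv_into[OF b] that]
    by (auto simp: idx_def)
  have idx_b: "idx (b i) = i" if "i < n" for i
    using bij_betw_inv_into_left[OF b] that by (simp add: idx_def)
  have topS: "topspace S = open_simplex p"
    unfolding S_def n_def by (rule topspace_open_simplex)
  have simplex: "x \<in> open_simplex p \<longleftrightarrow> (\<forall>i\<ge>n. x i = 0) \<and> (\<forall>i<n. 0 < x i) \<and> (\<Sum>i<n. x i) = 1" for x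
    by (simp add: open_simplex_def topspace_Euclidean_space n_def)

  define B where "B C i = based_weight z (class_weight C) (b i)" for C i
  \<comment> \<open>\<open>B C i\<close> depends on the representative, but the differences are
    fixed linear combinations of the coordinates and so are continuous. The value 0 from n on is
    what \<open>Euclidean_space\<close> asks for.\<close>
  define F where "F C i = (if i < n then 1 / (\<Sum>j<n. exp (B C j - B C i)) else 0)" for C i
  have sum_pos: "(\<Sum>j<n. exp (h j :: real)) > 0" for h
    using n(3) by (intro sum_pos) auto
  have F_eq: "F C i = exp (B C i) / (\<Sum>j<n. exp (B C j))" if "i < n" for C i
    using that by (simp add: F_def exp_diff flip: sum_divide_distrib)
  have F_in: "F C \<in> open_simplex p" for C
    unfolding simplex
  proof (intro conjI allI impI)
    have "(\<Sum>i<n. F C i) = (\<Sum>i<n. exp (B C i)) / (\<Sum>j<n. exp (B C j))"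
      unfolding sum_divide_distrib by (intro sum.cong) (auto simp: F_eq)
    then show "(\<Sum>i<n. F C i) = 1"
      using sum_pos[of "B C"] by simp
  next
    fix i assume "i < n"
    then show "0 < F C i"
      using sum_pos[of "\<lambda>j. B C j - B C i"] by (simp add: F_def)
  qed (simp add: F_def)
  have B_cont: "continuous_map mtopology euclideanreal (\<lambda>C. B C j - B C i)" if ij: "i < n" "j < n" for i j
  proof -
    obtain c where c: "\<And>v. based_weight z v (b j) - based_weight z v (b i)
        = (\<Sum>q\<in>quads Z. c q * log_cross_ratio v q)"
      using based_weight_diff[OF Z(1) p(2) bE[OF ij(2), unfolded E_def] bE[OF ij(1), unfolded E_def]] by blast
    show ?thesis
      unfolding B_def c
      by (intro continuous_map_sum continuous_map_real_mult continuous_map_coordinate finite_quads Z) simp_all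
  qed
  have F_cont: "continuous_map mtopology S F"
  proof -
    have "continuous_map mtopology euclideanreal (\<lambda>C. 1 / (\<Sum>j<n. exp (B C j - B C i)))" if "i < n" for i
    proof (intro continuous_map_real_divide continuous_map_sum)
      fix j assume "j \<in> {..<n}"
      then show "continuous_map mtopology euclideanreal (\<lambda>C. exp (B C j - B C i))"
        using B_cont[OF that, of j] by (simp add: continuous_map_atin tendsto_exp)
    next
      fix C
      show "(\<Sum>j<n. exp (B C j - B C i)) \<noteq> 0"
        using sum_pos[of "\<lambda>j. B C j - B C i"] by simp
    qed simp_all
    then have "continuous_map mtopology (Euclidean_space n) F"
      unfolding F_def by (subst continuous_map_componentwise_Euclidean_space) auto
    then show ?thesis
      unfolding S_def using F_in by (auto simp: continuous_map_in_subtopology)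
  qed

  define W where "W x = extend_by_zero z (\<lambda>e. ln (x (idx e)))" for x
  have "\<forall>x. \<exists>C\<in>big_teichmuller Z. \<forall>q\<in>quads Z. log_cross_ratio (class_weight C) q = log_cross_ratio (W x) q"
    using class_realisation[OF Z(1)] Z(2) by auto
  then obtain G where G: "\<And>x. G x \<in> big_teichmuller Z"
    "\<And>x q. q \<in> quads Z \<Longrightarrow> log_cross_ratio (class_weight (G x)) q = log_cross_ratio (W x) q"
    by metis
  have G_cont: "continuous_map S mtopology G"
  proof (rule continuous_map_into_mtopology)
    fix q assume q: "q \<in> quads Z"
    have *: "continuous_map S euclideanreal (\<lambda>x. W x {i, j})" if "i \<in> Z" "j \<in> Z" "i \<noteq> j" for i j
    proof (cases "z \<in> {i, j}")
      case False
      then have "{i, j} \<in> E"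
        using that by (auto simp: E_def)
      then have "x (idx {i, j}) \<noteq> 0" if "x \<in> topspace S" for x
        using idx(1) that by (force simp: topS simplex)
      moreover have "continuous_map S euclideanreal (\<lambda>x. x (idx {i, j}))"
        unfolding S_def n_def by (rule continuous_map_simplex_projection)
      ultimately have "continuous_map S euclideanreal (\<lambda>x. ln (x (idx {i, j})))"
        by (simp add: continuous_map_atin tendsto_ln)
      then show ?thesis
        using False by (simp add: W_def extend_by_zero_def)
    qed (auto simp: W_def extend_by_zero_def)
    have "continuous_map S euclideanreal (\<lambda>x. log_cross_ratio (W x) q)"
      using q by (cases q) (auto simp: quads_def intro!: continuous_map_add continuous_map_diff *)
    then show "continuous_map S euclideanreal (\<lambda>x. log_cross_ratio (class_weight (G x)) q)"
      using G(2)[OF q] by simp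
  qed (rule G)

  have "G (F C) = C" if C: "C \<in> big_teichmuller Z" for C
  proof (rule sep[OF G(1) C])
    fix q assume q: "q \<in> quads Z"
    \<comment> \<open>The logarithm of the normalising sum is the shift c in
      \<open>log_cross_ratio_extend_by_zero\<close>.\<close>
    have "ln (F C (idx e)) = based_weight z (class_weight C) e - ln (\<Sum>j<n. exp (B C j))"
      if "e \<in> edges (Z - {z})" for e
      using idx[of e] that sum_pos[of "B C"] by (simp add: F_eq ln_div B_def E_def)
    then have "log_cross_ratio (W (F C)) q = log_cross_ratio (class_weight C) q"
      unfolding W_def by (rule log_cross_ratio_extend_by_zero[OF q])
    then show "log_cross_ratio (class_weight (G (F C))) q = log_cross_ratio (class_weight C) q"
      using G(2)[OF q] by simp
  qed
  moreover have "F (G x) = x" if x: "x \<in> open_simplex p" for x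
  proof
    fix i
    show "F (G x) i = x i"
    proof (cases "i < n")
      case i: True
      have xpos: "x j > 0" if "j < n" for j
        using x that by (simp add: simplex)
      \<comment> \<open>\<open>W x\<close> vanishes on the edges through z, so basing it at z
        changes nothing.\<close>
      have W_b: "based_weight z (W x) (b j) = ln (x j)" if "j < n" for j
      proof -
        have "b j \<in> edges (Z - {z})"
          using bE[OF that] by (simp add: E_def)
        then show ?thesis
          using idx_b[OF that] by (auto simp: based_weight_def W_def extend_by_zero_def edges_def)
      qed
      \<comment> \<open>The weight of \<open>G x\<close> shares only its cross-ratios with
        \<open>W x\<close>, hence only differences can be compared.\<close>
      have "B (G x) j - B (G x) i = ln (x j) - ln (x i)" if "j < n" for j
        using based_weight_diff_cong[OF Z(1) p(2) bE[OF that, unfolded E_def] bE[OF i, unfolded E_def] G(2)]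
        by (simp add: B_def W_b that i)
      then have "(\<Sum>j<n. exp (B (G x) j - B (G x) i)) = (\<Sum>j<n. x j / x i)"
        using xpos i by (intro sum.cong) (auto simp: exp_diff)
      also have "\<dots> = 1 / x i"
        using x by (simp add: simplex flip: sum_divide_distrib)
      finally show ?thesis
        using i by (simp add: F_def)
    qed (use x in \<open>simp add: F_def simplex\<close>)
  qed
  ultimately have "homeomorphic_maps mtopology S F G"
    using F_cont G_cont by (simp add: homeomorphic_maps_def topS)
  then show ?thesis
    unfolding S_def n_def homeomorphic_space_def by blast
qed

theorem theorem5p1p8:
  fixes Z :: "'a set" and m :: nat
  assumes "finite Z" and "card Z = m" and "m \<ge> 4"
  shows "Metric_space (big_teichmuller Z) (moebius_dist Z) \<and>
    Metric_space.geodesic_space (big_teichmuller Z) (moebius_dist Z) \<and>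
    Metric_space.geodesically_complete (big_teichmuller Z) (moebius_dist Z) \<and>
    Metric_space.mtopology (big_teichmuller Z) (moebius_dist Z) homeomorphic_space
      subtopology (Euclidean_space (1 + m * (m - 3) div 2)) (open_simplex (m * (m - 3) div 2))"
proof -
  have Z: "finite Z" "card Z \<ge> 4"
    using assms by auto
  interpret coordinate_metric "big_teichmuller Z" "quads Z" "\<lambda>q C. log_cross_ratio (class_weight C) q"
      "moebius_dist Z"
    using coordinate_metric_big_teichmuller[OF Z] .
  obtain z where z: "z \<in> Z"
    using Z(2) by fastforce
  have "card (edges (Z - {z})) = 1 + m * (m - 3) div 2"
    using assms z choose_two_eq_simplex_dim[of m] by (simp add: card_edges)
  from homeomorphic_open_simplex[OF Z this z] show ?thesis
    using Metric_space_axioms geodesic_space geodesically_complete by blast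
qed

end
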